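(* Let $G=(V,E)$ be a finite simple graph with $V=\{1,\dots,n\}$, $n\ge 1$. Let $\mathbf{x}\in\Delta_n$ and suppose there exist two distinct $c_1,c_2\in\mathbb{R}$ such that $\mathbf{x}\in\mathrm{gKKT}(c_j)$ for $j=1,2$. Then $\mathbf{x}=\mathbf{x}^S$ for some (non-empty) $S\subseteq V$, and $G[S]$ is regular.
   Context: Graphs are finite, undirected, unweighted, without loops. $A$ is the adjacency matrix of $G$, $I$ the $n\times n$ identity matrix, $\mathbf 1$ the all-ones vector. $\Delta_n=\{\mathbf{x}\in\mathbb{R}^n:\mathbf{1}^\top\mathbf{x}=1,\ \mathbf{x}\ge\mathbf 0\}$. For non-empty $S\subseteq V$, the characteristic vector $\mathbf{x}^S\in\Delta_n$ has $x^S_i=|S|^{-1}$ if $i\in S$ and $0$ otherwise. $G[S]$ is the subgraph induced by $S$. For $c\in\mathbb{R}$, $\mathrm{gKKT}(c)$ is the set of generalized KKT points of the program $\max_{\mathbf{x}\in\Delta_n}\mathbf{x}^\top(A+cI)\mathbf{x}$: the set of $\mathbf{x}\in\Delta_n$ for which there exist $\mu_0\in\mathbb{R}$ and $\boldsymbol\mu\in\mathbb{R}^n$ with $2(A+cI)\mathbf{x}+\mu_0\mathbf{1}+\boldsymbol\mu=\mathbf 0$ and $\mu_ix_i=0$ for every $i\in V$ (no sign condition on $\boldsymbol\mu$). A graph is regular if all its nodes have the same degree. *)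

theory Defs
  imports "HOL-Analysis.Analysis"
begin

type_synonym 'a graph = "'a set \<times> 'a set set"

abbreviation verts :: "'a graph \<Rightarrow> 'a set" where
  "verts G \<equiv> fst G"

abbreviation edges :: "'a graph \<Rightarrow> 'a set set" where
  "edges G \<equiv> snd G"

text \<open>Edges are two-element sets of vertices, so there are no loops and no multiple edges.\<close>

definition simple_graph :: "'a graph \<Rightarrow> bool" where
  "simple_graph G \<longleftrightarrow> finite (verts G) \<and> (\<forall>e\<in>edges G. e \<subseteq> verts G \<and> card e = 2)"

definition induced_subgraph :: "'a graph \<Rightarrow> 'a set \<Rightarrow> 'a graph" where
  "induced_subgraph G S = (S, {e \<in> edges G. e \<subseteq> S})"

definition degree :: "'a graph \<Rightarrow> 'a \<Rightarrow> nat" where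
  "degree G v = card {w \<in> verts G. {v, w} \<in> edges G}"

definition regular :: "'a graph \<Rightarrow> bool" where
  "regular G \<longleftrightarrow> (\<exists>d. \<forall>v\<in>verts G. degree G v = d)"

text \<open>
  From here on the vertex set is the whole finite index type \<open>'n\<close>, which plays the role
  of \<open>{1, \<dots>, n}\<close> with \<open>n = CARD('n) \<ge> 1\<close>.
\<close>

definition adjacency_matrix :: "'n::finite graph \<Rightarrow> real^'n^'n" where
  "adjacency_matrix G = (\<chi> i j. if {i, j} \<in> edges G then 1 else 0)"

text \<open>The vector \<open>1 :: real^'n\<close> is the all-ones vector; \<open>mat 1\<close> is the identity matrix.\<close>

definition std_simplex :: "(real^'n::finite) set" where
  "std_simplex = {x. 1 \<bullet> x = 1 \<and> (\<forall>i. 0 \<le> x $ i)}"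

definition char_vec :: "'n::finite set \<Rightarrow> real^'n" where
  "char_vec S = (\<chi> i. if i \<in> S then inverse (real (card S)) else 0)"

definition gKKT :: "'n::finite graph \<Rightarrow> real \<Rightarrow> (real^'n) set" where
  "gKKT G c = {x \<in> std_simplex. \<exists>(\<mu>0::real) (\<mu>::real^'n).
     2 *\<^sub>R ((adjacency_matrix G + c *\<^sub>R mat 1) *v x) + \<mu>0 *\<^sub>R 1 + \<mu> = 0 \<and>
     (\<forall>i. \<mu> $ i * x $ i = 0)}"

end

theory Submission
  imports Defs
begin

text \<open>
  On the support of \<open>x\<close> the generalized KKT conditions say that \<open>A x + c x\<close> is constant.
  Subtracting these conditions for two values of \<open>c\<close> shows that \<open>x\<close> itself is constant on
  its support, hence a characteristic vector; then so is \<open>A x\<close>, whose entries there are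
  the degrees of the induced subgraph divided by the size of the support.
\<close>

text \<open>Complementarity forces \<open>\<mu> $ i = 0\<close> wherever \<open>x $ i\<close> is
  nonzero, so row \<open>i\<close> of the stationarity equation involves only the scalar multiplier,
  and the constant is \<open>- \<mu>0 / 2\<close>.\<close>

lemma gKKT_constant_on_support:
  assumes "x \<in> gKKT G c"
  obtains k where "\<And>i. x $ i \<noteq> 0 \<Longrightarrow> (adjacency_matrix G *v x) $ i + c * x $ i = k"
proof -
  from assms obtain \<mu>0 :: real and \<mu> where
    eq: "2 *\<^sub>R ((adjacency_matrix G + c *\<^sub>R mat 1) *v x) + \<mu>0 *\<^sub>R 1 + \<mu> = 0"
    and compl: "\<And>i. \<mu> $ i * x $ i = 0"
    unfolding gKKT_def by blast
  have "(adjacency_matrix G *v x) $ i + c * x $ i = - \<mu>0 / 2" if "x $ i \<noteq> 0" for i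
  proof -
    have "\<mu> $ i = 0"
      using compl[of i] that by simp
    moreover have "(2 *\<^sub>R ((adjacency_matrix G + c *\<^sub>R mat 1) *v x) + \<mu>0 *\<^sub>R 1 + \<mu>) $ i = 0"
      by (simp add: eq)
    ultimately show ?thesis
      by (simp add: matrix_vector_mult_add_rdistrib scaleR_matrix_vector_assoc[symmetric])
  qed
  then show thesis
    by (rule that)
qed

text \<open>The entries of \<open>x\<close> sum to 1, so the size of the support times
  \<open>t\<close> is 1. This excludes an empty support and determines \<open>t\<close>.\<close>

lemma std_simplex_constant_on_support:
  fixes x :: "real^'n::finite"
  assumes x: "x \<in> std_simplex" and const: "\<And>i. x $ i \<noteq> 0 \<Longrightarrow> x $ i = t"
  shows "{i. x $ i \<noteq> 0} \<noteq> {}" and "x = char_vec {i. x $ i \<noteq> 0}"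
proof -
  let ?S = "{i. x $ i \<noteq> 0}"
  have "1 = (\<Sum>i\<in>UNIV. x $ i)"
    using x by (simp add: std_simplex_def inner_vec_def)
  also have "\<dots> = (\<Sum>i\<in>?S. x $ i)"
    by (rule sum.mono_neutral_right) auto
  also have "\<dots> = (\<Sum>i\<in>?S. t)"
    by (rule sum.cong) (auto intro: const)
  finally have card_t: "real (card ?S) * t = 1"
    by simp
  then show "?S \<noteq> {}"
    by (metis card.empty mult_zero_left of_nat_0 zero_neq_one)
  have t: "inverse (real (card ?S)) = t"
    using card_t by (rule inverse_unique)
  show "x = char_vec ?S"
    unfolding vec_eq_iff
  proof
    fix i
    show "x $ i = char_vec ?S $ i"
    proof (cases "x $ i = 0")
      case True
      then show ?thesis
        by (simp add: char_vec_def)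
    next
      case False
      with const[OF False] show ?thesis
        by (simp add: char_vec_def t)
    qed
  qed
qed

lemma adjacency_matrix_char_vec:
  assumes "i \<in> S"
  shows "(adjacency_matrix G *v char_vec S) $ i
    = real (degree (induced_subgraph G S) i) / real (card S)"
proof -
  have "(adjacency_matrix G *v char_vec S) $ i
      = (\<Sum>j\<in>{j \<in> S. {i, j} \<in> edges G}. inverse (real (card S)))"
    unfolding matrix_vector_mult_def adjacency_matrix_def char_vec_def vec_lambda_beta
    by (intro sum.mono_neutral_cong_right) auto
  \<comment> \<open>Since \<open>i\<close> lies in \<open>S\<close>, an edge from \<open>i\<close>
    to \<open>j\<close> in \<open>S\<close> is contained in \<open>S\<close> and so survives in the
    induced subgraph.\<close>
  moreover have "{j \<in> S. {i, j} \<in> edges G}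
      = {j \<in> verts (induced_subgraph G S). {i, j} \<in> edges (induced_subgraph G S)}"
    using assms by (auto simp: induced_subgraph_def)
  ultimately show ?thesis
    by (simp add: degree_def divide_inverse)
qed

theorem proposition5:
  fixes G :: "'n::finite graph" and x :: "real^'n" and c1 c2 :: real
  assumes "simple_graph G" and "verts G = UNIV"
    and "x \<in> std_simplex"
    and "c1 \<noteq> c2"
    and "x \<in> gKKT G c1" and "x \<in> gKKT G c2"
  shows "\<exists>S. S \<noteq> {} \<and> S \<subseteq> verts G \<and> x = char_vec S \<and> regular (induced_subgraph G S)"
proof -
  obtain k1 where k1: "\<And>i. x $ i \<noteq> 0 \<Longrightarrow> (adjacency_matrix G *v x) $ i + c1 * x $ i = k1"
    using gKKT_constant_on_support[OF assms(5)] by blast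
  obtain k2 where k2: "\<And>i. x $ i \<noteq> 0 \<Longrightarrow> (adjacency_matrix G *v x) $ i + c2 * x $ i = k2"
    using gKKT_constant_on_support[OF assms(6)] by blast
  \<comment> \<open>Subtracting \<open>k2\<close> from \<open>k1\<close> cancels the entry of
    \<open>A x\<close> and leaves \<open>(c1 - c2) * x $ i = k1 - k2\<close> on the support.\<close>
  define t where "t = (k1 - k2) / (c1 - c2)"
  have const: "x $ i = t" if "x $ i \<noteq> 0" for i
  proof -
    have "x $ i * (c1 - c2) = k1 - k2"
      using k1[OF that] k2[OF that] by (simp add: algebra_simps)
    with \<open>c1 \<noteq> c2\<close> show ?thesis
      by (simp add: t_def eq_divide_eq)
  qed
  define S where "S = {i. x $ i \<noteq> 0}"
  have S: "S \<noteq> {}" "x = char_vec S"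
    unfolding S_def by (rule std_simplex_constant_on_support[OF assms(3) const], assumption)+
  have degree_eq: "real (degree (induced_subgraph G S) i) = real (card S) * (k1 - c1 * t)"
    if "i \<in> S" for i
  proof -
    have "x $ i \<noteq> 0"
      using that by (simp add: S_def)
    then have "(adjacency_matrix G *v x) $ i = k1 - c1 * t"
      using k1[of i] const[of i] by simp
    moreover have "(adjacency_matrix G *v x) $ i
        = real (degree (induced_subgraph G S) i) / real (card S)"
      using adjacency_matrix_char_vec[OF that, of G] unfolding S(2)[symmetric] .
    moreover have "card S \<noteq> 0"
      using S(1) by simp
    ultimately show ?thesis
      by (simp add: field_simps)
  qed
  \<comment> \<open>The common value in \<open>degree_eq\<close> is a real expression, whereas
    \<open>regular\<close> asks for a natural number; the degree of any one vertex of
    \<open>S\<close> provides it.\<close>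
  obtain v where "v \<in> S"
    using S(1) by blast
  then have "\<forall>i\<in>S. degree (induced_subgraph G S) i = degree (induced_subgraph G S) v"
    by (metis degree_eq of_nat_eq_iff)
  then have "regular (induced_subgraph G S)"
    by (auto simp: regular_def induced_subgraph_def)
  with S assms(2) show ?thesis
    by blast
qed

end
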